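(* Let $\tau$ be a finite unary vocabulary, $t = 2^{|\tau|}$, $c_\tau := 15|\tau|2^{|\tau|}$, $d$ a positive integer, and $\mathfrak{M}$ a $\tau$-model of size $n$. Let $\overline{m} = (m_1,\dots,m_t)$ be the tuple associated with the $\equiv_d$-class of $\mathfrak{M}$, with its entries listed in ascending order, and let $m_r$ be the largest entry of $\overline{m}$ that is below $d$. Then $C_d(\mathfrak{M}) \leq 3d + 3m_r + c_\tau$. Additionally, if $m_{t-1} < d$, then $C_d(\mathfrak{M}) \leq 6m_{t-1} + c_\tau$.
   Context: A $\tau$-model of size $n$ has domain $\{1,\dots,n\}$ and interprets each unary symbol of $\tau$ as a subset. A $\tau$-type is a subset $\pi\subseteq\tau$; a point realizes $\pi$ if it lies in exactly the relations named in $\pi$; $|\pi|_{\mathfrak{M}}$ is the number of points of $\mathfrak{M}$ realizing $\pi$. For $\tau$-models $\mathfrak{M},\mathfrak{M}'$ of size $n$, $\mathfrak{M}\equiv_d\mathfrak{M}'$ iff every type $\pi$ with $|\pi|_{\mathfrak{M}}<d$ satisfies $|\pi|_{\mathfrak{M}}=|\pi|_{\mathfrak{M}'}$ (equivalently, they satisfy the same sentences of quantifier rank at most $d$). Enumerating the $t$ types as $\pi_1,\dots,\pi_t$, the $\equiv_d$-class of $\mathfrak{M}$ is described by the tuple whose entries are $\min(|\pi_i|_{\mathfrak{M}}, d)$. $\mathrm{FO}_d[\tau]$ is the set of first-order formulas (negation normal form) of quantifier rank at most $d$. The size of a formula is the number of atomic formulas (negated or not), conjunctions, disjunctions and quantifiers;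 negations are not counted. $C_d(\mathfrak{M})$ is the minimum size of an $\mathrm{FO}_d[\tau]$-sentence $\varphi$ such that for every $\tau$-model $\mathfrak{M}'$ of size $n$, $\mathfrak{M}'\models\varphi$ iff $\mathfrak{M}'\equiv_d\mathfrak{M}$. *)

theory Defs
  imports Main "HOL-Library.Multiset" "HOL-Library.Extended_Nat"
begin

datatype 'p atom = Pred 'p nat | Eq nat nat

datatype 'p fm =
    Pos "'p atom"
  | Neg "'p atom"
  | Conj "'p fm" "'p fm"
  | Disj "'p fm" "'p fm"
  | Ex nat "'p fm"
  | All nat "'p fm"

fun atom_vars :: "'p atom \<Rightarrow> nat set" where
  "atom_vars (Pred P x) = {x}"
| "atom_vars (Eq x y) = {x, y}"

fun atom_preds :: "'p atom \<Rightarrow> 'p set" where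
  "atom_preds (Pred P x) = {P}"
| "atom_preds (Eq x y) = {}"

fun fv :: "'p fm \<Rightarrow> nat set" where
  "fv (Pos a) = atom_vars a"
| "fv (Neg a) = atom_vars a"
| "fv (Conj f g) = fv f \<union> fv g"
| "fv (Disj f g) = fv f \<union> fv g"
| "fv (Ex x f) = fv f - {x}"
| "fv (All x f) = fv f - {x}"

fun preds :: "'p fm \<Rightarrow> 'p set" where
  "preds (Pos a) = atom_preds a"
| "preds (Neg a) = atom_preds a"
| "preds (Conj f g) = preds f \<union> preds g"
| "preds (Disj f g) = preds f \<union> preds g"
| "preds (Ex x f) = preds f"
| "preds (All x f) = preds f"

fun qrank :: "'p fm \<Rightarrow> nat" where
  "qrank (Pos a) = 0"
| "qrank (Neg a) = 0"
| "qrank (Conj f g) = max (qrank f) (qrank g)"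
| "qrank (Disj f g) = max (qrank f) (qrank g)"
| "qrank (Ex x f) = Suc (qrank f)"
| "qrank (All x f) = Suc (qrank f)"

text \<open>Negations are not counted.\<close>

fun fsize :: "'p fm \<Rightarrow> nat" where
  "fsize (Pos a) = 1"
| "fsize (Neg a) = 1"
| "fsize (Conj f g) = fsize f + fsize g + 1"
| "fsize (Disj f g) = fsize f + fsize g + 1"
| "fsize (Ex x f) = fsize f + 1"
| "fsize (All x f) = fsize f + 1"

definition FO :: "nat \<Rightarrow> 'p set \<Rightarrow> 'p fm set" where
  "FO d \<tau> = {f. preds f \<subseteq> \<tau> \<and> qrank f \<le> d}"

definition sentence :: "'p fm \<Rightarrow> bool" where
  "sentence f \<longleftrightarrow> fv f = {}"

text \<open>A model of size \<open>n\<close> has the domain \<open>{1..n}\<close> and is given by its interpretation alone.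
  The values of the interpretation outside the vocabulary play no role.\<close>

definition is_model :: "'p set \<Rightarrow> nat \<Rightarrow> ('p \<Rightarrow> nat set) \<Rightarrow> bool" where
  "is_model \<tau> n M \<longleftrightarrow> (\<forall>P\<in>\<tau>. M P \<subseteq> {1..n})"

fun atom_sat :: "('p \<Rightarrow> nat set) \<Rightarrow> (nat \<Rightarrow> nat) \<Rightarrow> 'p atom \<Rightarrow> bool" where
  "atom_sat M s (Pred P x) \<longleftrightarrow> s x \<in> M P"
| "atom_sat M s (Eq x y) \<longleftrightarrow> s x = s y"

fun sat :: "nat \<Rightarrow> ('p \<Rightarrow> nat set) \<Rightarrow> (nat \<Rightarrow> nat) \<Rightarrow> 'p fm \<Rightarrow> bool" where
  "sat n M s (Pos a) \<longleftrightarrow> atom_sat M s a"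
| "sat n M s (Neg a) \<longleftrightarrow> \<not> atom_sat M s a"
| "sat n M s (Conj f g) \<longleftrightarrow> sat n M s f \<and> sat n M s g"
| "sat n M s (Disj f g) \<longleftrightarrow> sat n M s f \<or> sat n M s g"
| "sat n M s (Ex x f) \<longleftrightarrow> (\<exists>a\<in>{1..n}. sat n M (s(x := a)) f)"
| "sat n M s (All x f) \<longleftrightarrow> (\<forall>a\<in>{1..n}. sat n M (s(x := a)) f)"

text \<open>Only used for sentences, whose truth does not depend on the assignment
  (lemma \<open>models_iff_sat\<close>).\<close>

definition models :: "nat \<Rightarrow> ('p \<Rightarrow> nat set) \<Rightarrow> 'p fm \<Rightarrow> bool" where
  "models n M f \<longleftrightarrow> (\<forall>s. sat n M s f)"

lemma atom_sat_cong:
  assumes "\<And>x. x \<in> atom_vars a \<Longrightarrow> s x = s' x"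
  shows "atom_sat M s a = atom_sat M s' a"
  using assms by (cases a) auto

lemma sat_cong:
  assumes "\<And>x. x \<in> fv f \<Longrightarrow> s x = s' x"
  shows "sat n M s f = sat n M s' f"
  using assms
proof (induction f arbitrary: s s')
  case (Pos a)
  then show ?case using atom_sat_cong[of a s s' M] by simp
next
  case (Neg a)
  then show ?case using atom_sat_cong[of a s s' M] by simp
next
  case (Conj f g)
  have "sat n M s f = sat n M s' f" by (rule Conj.IH(1)) (simp add: Conj.prems)
  moreover have "sat n M s g = sat n M s' g" by (rule Conj.IH(2)) (simp add: Conj.prems)
  ultimately show ?case by simp
next
  case (Disj f g)
  have "sat n M s f = sat n M s' f" by (rule Disj.IH(1)) (simp add: Disj.prems)
  moreover have "sat n M s g = sat n M s' g" by (rule Disj.IH(2)) (simp add: Disj.prems)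
  ultimately show ?case by simp
next
  case (Ex x f)
  have "sat n M (s(x := a)) f = sat n M (s'(x := a)) f" for a
    by (rule Ex.IH) (simp add: Ex.prems)
  then show ?case by simp
next
  case (All x f)
  have "sat n M (s(x := a)) f = sat n M (s'(x := a)) f" for a
    by (rule All.IH) (simp add: All.prems)
  then show ?case by simp
qed

lemma models_iff_sat:
  assumes "sentence f"
  shows "models n M f \<longleftrightarrow> sat n M s f"
  unfolding models_def using sat_cong[of f _ s n M] assms by (auto simp: sentence_def)

text \<open>The types over \<open>\<tau>\<close> are the elements of \<open>Pow \<tau>\<close>; \<open>type_card \<tau> n M \<pi>\<close> is the
  number of points realizing \<open>\<pi>\<close>.\<close>

definition type_card :: "'p set \<Rightarrow> nat \<Rightarrow> ('p \<Rightarrow> nat set) \<Rightarrow> 'p set \<Rightarrow> nat" where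
  "type_card \<tau> n M \<pi> = card {a \<in> {1..n}. {P \<in> \<tau>. a \<in> M P} = \<pi>}"

text \<open>The condition on the types realized fewer than \<open>d\<close> times is imposed on both models:
  imposed on one of them only, the relation would not be symmetric and would not
  coincide with agreement on all sentences of quantifier rank at most \<open>d\<close>.\<close>

definition equiv_d :: "'p set \<Rightarrow> nat \<Rightarrow> nat \<Rightarrow> ('p \<Rightarrow> nat set) \<Rightarrow> ('p \<Rightarrow> nat set) \<Rightarrow> bool" where
  "equiv_d \<tau> n d M M' \<longleftrightarrow>
     (\<forall>\<pi>\<in>Pow \<tau>. type_card \<tau> n M \<pi> < d \<or> type_card \<tau> n M' \<pi> < d \<longrightarrow>
        type_card \<tau> n M \<pi> = type_card \<tau> n M' \<pi>)"

lemma equiv_d_iff_min: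
  "equiv_d \<tau> n d M M' \<longleftrightarrow>
     (\<forall>\<pi>\<in>Pow \<tau>. min (type_card \<tau> n M \<pi>) d = min (type_card \<tau> n M' \<pi>) d)"
  unfolding equiv_d_def by (rule ball_cong) (auto simp: min_def)

text \<open>The infimum is taken in \<^typ>\<open>enat\<close>: it is the minimum if a defining
  sentence exists, and \<open>\<infinity>\<close> (rather than a spurious \<open>0\<close>) if there is none.\<close>

definition description_complexity ::
  "'p set \<Rightarrow> nat \<Rightarrow> nat \<Rightarrow> ('p \<Rightarrow> nat set) \<Rightarrow> enat" where
  "description_complexity \<tau> n d M =
     (INF f \<in> {f \<in> FO d \<tau>. sentence f \<and>
                (\<forall>M'. is_model \<tau> n M' \<longrightarrow> (models n M' f \<longleftrightarrow> equiv_d \<tau> n d M' M))}.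
        enat (fsize f))"

definition class_tuple :: "'p set \<Rightarrow> nat \<Rightarrow> nat \<Rightarrow> ('p \<Rightarrow> nat set) \<Rightarrow> nat list" where
  "class_tuple \<tau> n d M =
     sorted_list_of_multiset (image_mset (\<lambda>\<pi>. min (type_card \<tau> n M \<pi>) d) (mset_set (Pow \<tau>)))"

lemma sorted_class_tuple: "sorted (class_tuple \<tau> n d M)"
  by (simp add: class_tuple_def)

lemma length_class_tuple:
  assumes "finite \<tau>"
  shows "length (class_tuple \<tau> n d M) = 2 ^ card \<tau>"
proof -
  have "length (class_tuple \<tau> n d M) = size (mset (class_tuple \<tau> n d M))"
    by (rule size_mset[symmetric])
  then show ?thesis
    using assms by (simp add: class_tuple_def card_Pow)
qed

text \<open>Entries are numbered from \<open>1\<close>.\<close>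

definition entry :: "nat list \<Rightarrow> nat \<Rightarrow> nat" where
  "entry m i = m ! (i - 1)"

text \<open>If no entry is below \<open>d\<close>, the value is \<open>0\<close>.\<close>

definition largest_below :: "nat \<Rightarrow> nat list \<Rightarrow> nat" where
  "largest_below d m = Max (insert 0 {k \<in> set m. k < d})"

definition c_tau :: "'p set \<Rightarrow> nat" where
  "c_tau \<tau> = 15 * card \<tau> * 2 ^ card \<tau>"

end

theory Submission
  imports Defs
begin

text \<open>Two chains of quantifiers bound the multiplicities of all types simultaneously.
  That a nonempty type has at least \<open>l\<close> points for a type-dependent \<open>l \<le> D\<close> is expressed by
  \<open>\<forall>x\<^sub>1 \<dots> x\<^sub>D\<^sub>-\<^sub>1 \<exists>y\<close>: \<open>y\<close> has the type of \<open>x\<^sub>1\<close> and differs from \<open>x\<^sub>1, \<dots>, x\<^sub>l\<^sub>-\<^sub>1\<close>. That it has at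
  most \<open>u \<le> U\<close> points is expressed by \<open>\<forall>x\<^sub>1 \<exists>x\<^sub>2 \<dots> x\<^sub>U \<forall>y\<close>: if \<open>y\<close> has the type of \<open>x\<^sub>1\<close>, then \<open>y\<close> is
  among \<open>x\<^sub>1, \<dots>, x\<^sub>u\<close>. The variable \<open>x\<^sub>1\<close> serves as a selector for the type, so that the (in)equalities
  are shared by all types and each index costs three symbols. Which types are
  empty is stated separately. The first bound takes \<open>D = d\<close> and
  \<open>U = m\<^sub>r\<close>. For the second, all types but one have to be counted exactly, the last multiplicity
  being determined by \<open>n\<close>, so \<open>D = U = m\<^sub>t\<^sub>-\<^sub>1\<close>.\<close>

section \<open>Points realizing a type, and the number of points as the sum of the
  multiplicities\<close>

definition rtype :: "'p set \<Rightarrow> ('p \<Rightarrow> nat set) \<Rightarrow> nat \<Rightarrow> 'p set" where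
  "rtype \<tau> M a = {P \<in> \<tau>. a \<in> M P}"

definition realizing :: "'p set \<Rightarrow> nat \<Rightarrow> ('p \<Rightarrow> nat set) \<Rightarrow> 'p set \<Rightarrow> nat set" where
  "realizing \<tau> n M \<pi> = {a \<in> {1..n}. rtype \<tau> M a = \<pi>}"

lemma type_card_realizing: "type_card \<tau> n M \<pi> = card (realizing \<tau> n M \<pi>)"
  by (simp add: type_card_def realizing_def rtype_def)

lemma finite_realizing: "finite (realizing \<tau> n M \<pi>)"
  by (simp add: realizing_def)

lemma type_card_pos_iff: "type_card \<tau> n M \<pi> > 0 \<longleftrightarrow> (\<exists>a\<in>{1..n}. rtype \<tau> M a = \<pi>)"
  by (auto simp: type_card_realizing card_gt_0_iff finite_realizing) (auto simp: realizing_def)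

lemma rtype_Pow: "rtype \<tau> M a \<in> Pow \<tau>"
  by (auto simp: rtype_def)

text \<open>Every point realizes exactly one type, so the points are partitioned by their types.
  This is how \<open>n\<close> determines the multiplicity of one type from those of all the
  others.\<close>

lemma sum_type_card:
  assumes "finite \<tau>"
  shows "(\<Sum>\<pi>\<in>Pow \<tau>. type_card \<tau> n M \<pi>) = n"
proof -
  have "(\<Sum>\<pi>\<in>Pow \<tau>. card {a \<in> {1..n}. rtype \<tau> M a = \<pi>}) = card {1..n}"
    using sum.group[of "{1..n}" "Pow \<tau>" "rtype \<tau> M" "\<lambda>_. 1::nat"] assms rtype_Pow[of \<tau> M]
    by (auto simp del: PowI)
  then show ?thesis
    by (simp add: type_card_realizing realizing_def)
qed

subsection \<open>Formulas for types\<close>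

text \<open>The clause for one-element lists ends the conjunction without a neutral conjunct, so
  that a nonempty \<open>Ps\<close> costs exactly \<open>2 * length Ps - 1\<close> symbols.\<close>

fun type_fm :: "'p set \<Rightarrow> nat \<Rightarrow> 'p list \<Rightarrow> 'p fm" where
  "type_fm \<pi> x [] = Pos (Eq x x)"
| "type_fm \<pi> x [P] = (if P \<in> \<pi> then Pos (Pred P x) else Neg (Pred P x))"
| "type_fm \<pi> x (P # Ps) =
     Conj (if P \<in> \<pi> then Pos (Pred P x) else Neg (Pred P x)) (type_fm \<pi> x Ps)"

text \<open>The negation of \<open>type_fm\<close> in negation normal form. It has the same size,
  since negated atoms cost as much as plain ones.\<close>

fun ntype_fm :: "'p set \<Rightarrow> nat \<Rightarrow> 'p list \<Rightarrow> 'p fm" where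
  "ntype_fm \<pi> x [] = Neg (Eq x x)"
| "ntype_fm \<pi> x [P] = (if P \<in> \<pi> then Neg (Pred P x) else Pos (Pred P x))"
| "ntype_fm \<pi> x (P # Ps) =
     Disj (if P \<in> \<pi> then Neg (Pred P x) else Pos (Pred P x)) (ntype_fm \<pi> x Ps)"

lemma type_fm_syntax:
  "fv (type_fm \<pi> x Ps) = {x}" "preds (type_fm \<pi> x Ps) = set Ps" "qrank (type_fm \<pi> x Ps) = 0"
  "Ps \<noteq> [] \<Longrightarrow> fsize (type_fm \<pi> x Ps) + 1 = 2 * length Ps"
  by (induction \<pi> x Ps rule: type_fm.induct) auto

lemma ntype_fm_syntax:
  "fv (ntype_fm \<pi> x Ps) = {x}" "preds (ntype_fm \<pi> x Ps) = set Ps" "qrank (ntype_fm \<pi> x Ps) = 0"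
  "Ps \<noteq> [] \<Longrightarrow> fsize (ntype_fm \<pi> x Ps) + 1 = 2 * length Ps"
  by (induction \<pi> x Ps rule: ntype_fm.induct) auto

lemma sat_type_fm:
  assumes "\<pi> \<in> Pow (set Ps)"
  shows "sat n M s (type_fm \<pi> x Ps) \<longleftrightarrow> rtype (set Ps) M (s x) = \<pi>"
proof -
  have "sat n M s (type_fm \<pi> x Ps) \<longleftrightarrow> (\<forall>P\<in>set Ps. P \<in> \<pi> \<longleftrightarrow> s x \<in> M P)"
    by (induction \<pi> x Ps rule: type_fm.induct) auto
  then show ?thesis using assms by (auto simp: rtype_def)
qed

lemma sat_ntype_fm:
  assumes "\<pi> \<in> Pow (set Ps)"
  shows "sat n M s (ntype_fm \<pi> x Ps) \<longleftrightarrow> rtype (set Ps) M (s x) \<noteq> \<pi>"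
proof -
  have "sat n M s (ntype_fm \<pi> x Ps) \<longleftrightarrow> \<not> (\<forall>P\<in>set Ps. P \<in> \<pi> \<longleftrightarrow> s x \<in> M P)"
    by (induction \<pi> x Ps rule: ntype_fm.induct) auto
  then show ?thesis using assms by (auto simp: rtype_def)
qed

definition both_fm :: "'p list \<Rightarrow> 'p set \<Rightarrow> 'p fm" where
  "both_fm Ps \<pi> = Conj (type_fm \<pi> 1 Ps) (type_fm \<pi> 0 Ps)"

definition nboth_fm :: "'p list \<Rightarrow> 'p set \<Rightarrow> 'p fm" where
  "nboth_fm Ps \<pi> = Disj (ntype_fm \<pi> 1 Ps) (ntype_fm \<pi> 0 Ps)"

lemma both_fm_syntax:
  "fv (both_fm Ps \<pi>) = {0, 1}" "preds (both_fm Ps \<pi>) = set Ps" "qrank (both_fm Ps \<pi>) = 0"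
  "Ps \<noteq> [] \<Longrightarrow> fsize (both_fm Ps \<pi>) + 1 = 4 * length Ps"
  using type_fm_syntax(4)[of Ps \<pi> 0] type_fm_syntax(4)[of Ps \<pi> 1]
  by (auto simp: both_fm_def type_fm_syntax(1-3))

lemma nboth_fm_syntax:
  "fv (nboth_fm Ps \<pi>) = {0, 1}" "preds (nboth_fm Ps \<pi>) = set Ps" "qrank (nboth_fm Ps \<pi>) = 0"
  "Ps \<noteq> [] \<Longrightarrow> fsize (nboth_fm Ps \<pi>) + 1 = 4 * length Ps"
  using ntype_fm_syntax(4)[of Ps \<pi> 0] ntype_fm_syntax(4)[of Ps \<pi> 1]
  by (auto simp: nboth_fm_def ntype_fm_syntax(1-3))

subsection \<open>Blocks of connectives and quantifiers\<close>

text \<open>In the size equation \<open>c\<close> charges each member of the list together with the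
  connective that attaches it.\<close>

lemma foldr_Conj:
  "sat n M s (foldr Conj fs g) \<longleftrightarrow> (\<forall>f\<in>set fs. sat n M s f) \<and> sat n M s g"
  "fv (foldr Conj fs g) = (\<Union>f\<in>set fs. fv f) \<union> fv g"
  "preds (foldr Conj fs g) = (\<Union>f\<in>set fs. preds f) \<union> preds g"
  "(\<And>f. f \<in> set fs \<Longrightarrow> qrank f \<le> k) \<Longrightarrow> qrank g \<le> k \<Longrightarrow> qrank (foldr Conj fs g) \<le> k"
  "(\<And>f. f \<in> set fs \<Longrightarrow> fsize f + 1 = c) \<Longrightarrow> fsize (foldr Conj fs g) = c * length fs + fsize g"
  by (induction fs) auto

lemma foldr_Disj:
  "sat n M s (foldr Disj fs g) \<longleftrightarrow> (\<exists>f\<in>set fs. sat n M s f) \<or> sat n M s g"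
  "fv (foldr Disj fs g) = (\<Union>f\<in>set fs. fv f) \<union> fv g"
  "preds (foldr Disj fs g) = (\<Union>f\<in>set fs. preds f) \<union> preds g"
  "(\<And>f. f \<in> set fs \<Longrightarrow> qrank f \<le> k) \<Longrightarrow> qrank g \<le> k \<Longrightarrow> qrank (foldr Disj fs g) \<le> k"
  "(\<And>f. f \<in> set fs \<Longrightarrow> fsize f + 1 = c) \<Longrightarrow> fsize (foldr Disj fs g) = c * length fs + fsize g"
  by (induction fs) auto

lemma foldr_quantifier_syntax:
  "fv (foldr All xs f) = fv f - set xs" "fv (foldr Ex xs f) = fv f - set xs"
  "preds (foldr All xs f) = preds f" "preds (foldr Ex xs f) = preds f"
  "qrank (foldr All xs f) = length xs + qrank f" "qrank (foldr Ex xs f) = length xs + qrank f"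
  "fsize (foldr All xs f) = length xs + fsize f" "fsize (foldr Ex xs f) = length xs + fsize f"
  by (induction xs) auto

text \<open>A block of quantifiers is treated as one choice of an assignment that may differ from
  \<open>s\<close> only on the block. The chains can then be evaluated under a single
  \<open>s'\<close>.\<close>

lemma sat_foldr_Ex:
  "sat n M s (foldr Ex xs f) \<longleftrightarrow>
     (\<exists>s'. (\<forall>x. x \<notin> set xs \<longrightarrow> s' x = s x) \<and> (\<forall>x\<in>set xs. s' x \<in> {1..n}) \<and> sat n M s' f)"
proof (induction xs arbitrary: s)
  case Nil
  have "s' = s" if "\<forall>x. s' x = s x" for s' using that by auto
  then show ?case by auto
next
  case (Cons x xs)
  have "(\<exists>a\<in>{1..n}. \<exists>s'. (\<forall>z. z \<notin> set xs \<longrightarrow> s' z = (s(x := a)) z) \<and>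
           (\<forall>z\<in>set xs. s' z \<in> {1..n}) \<and> sat n M s' f) \<longleftrightarrow>
     (\<exists>s'. (\<forall>z. z \<notin> set (x # xs) \<longrightarrow> s' z = s z) \<and>
           (\<forall>z\<in>set (x # xs). s' z \<in> {1..n}) \<and> sat n M s' f)" (is "?L \<longleftrightarrow> ?R")
  proof
    assume ?L
    then obtain a s' where "a \<in> {1..n}" "\<forall>z. z \<notin> set xs \<longrightarrow> s' z = (s(x := a)) z"
      "\<forall>z\<in>set xs. s' z \<in> {1..n}" "sat n M s' f" by blast
    \<comment> \<open>If \<open>x\<close> occurs again in \<open>xs\<close>, its inner value
      overrides \<open>a\<close>; otherwise \<open>s' x = a\<close>.\<close>
    then show ?R by (intro exI[of _ s']) (cases "x \<in> set xs"; auto)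
  next
    assume ?R
    then obtain s' where s': "\<forall>z. z \<notin> set (x # xs) \<longrightarrow> s' z = s z"
      "\<forall>z\<in>set (x # xs). s' z \<in> {1..n}" "sat n M s' f" by blast
    then show ?L by (intro bexI[of _ "s' x"] exI[of _ s']) auto
  qed
  then show ?case by (simp only: foldr.simps o_apply sat.simps Cons.IH)
qed

text \<open>Formulas have no negation connective, so negation is pushed down to the atoms. This
  transfers the law for existential blocks to universal ones.\<close>

fun dual :: "'p fm \<Rightarrow> 'p fm" where
  "dual (Pos a) = Neg a"
| "dual (Neg a) = Pos a"
| "dual (Conj f g) = Disj (dual f) (dual g)"
| "dual (Disj f g) = Conj (dual f) (dual g)"
| "dual (Ex x f) = All x (dual f)"
| "dual (All x f) = Ex x (dual f)"

lemma sat_dual: "sat n M s (dual f) \<longleftrightarrow> \<not> sat n M s f"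
  by (induction f arbitrary: s) auto

lemma dual_foldr_All: "dual (foldr All xs f) = foldr Ex xs (dual f)"
  by (induction xs) auto

lemma sat_foldr_All:
  "sat n M s (foldr All xs f) \<longleftrightarrow>
     (\<forall>s'. (\<forall>x. x \<notin> set xs \<longrightarrow> s' x = s x) \<longrightarrow> (\<forall>x\<in>set xs. s' x \<in> {1..n}) \<longrightarrow> sat n M s' f)"
  using sat_foldr_Ex[of n M s xs "dual f"] sat_dual[of n M s "foldr All xs f"]
  unfolding dual_foldr_All sat_dual by blast

subsection \<open>The two chains\<close>

text \<open>Variable \<open>0\<close> plays the role of \<open>y\<close>, variable \<open>1\<close> selects the type, and each type is tested
  only once, at the position of the chain given by its multiplicity.\<close>

primrec low_fm :: "'p list \<Rightarrow> 'p set list \<Rightarrow> ('p set \<Rightarrow> nat) \<Rightarrow> nat \<Rightarrow> nat \<Rightarrow> 'p fm" where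
  "low_fm Ps ts l 0 j =
     foldr Disj (map (both_fm Ps) (filter (\<lambda>\<pi>. l \<pi> = j) ts)) (Neg (Eq 0 0))"
| "low_fm Ps ts l (Suc k) j =
     foldr Disj (map (both_fm Ps) (filter (\<lambda>\<pi>. l \<pi> = j) ts))
       (Conj (Neg (Eq 0 j)) (low_fm Ps ts l k (Suc j)))"

primrec up_fm :: "'p list \<Rightarrow> 'p set list \<Rightarrow> ('p set \<Rightarrow> nat) \<Rightarrow> nat \<Rightarrow> nat \<Rightarrow> 'p fm" where
  "up_fm Ps ts u 0 j = Pos (Eq 0 0)"
| "up_fm Ps ts u (Suc k) j =
     Disj (Pos (Eq 0 j))
       (foldr Conj (map (nboth_fm Ps) (filter (\<lambda>\<pi>. u \<pi> = j) ts)) (up_fm Ps ts u k (Suc j)))"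

text \<open>Separates the types tested at position \<open>j\<close> from those left to the rest of
  the chain, so that the size inductions charge each type at most once.\<close>

lemma length_filter_level:
  "length (filter (\<lambda>x. l x = (j::nat)) xs) + length (filter (\<lambda>x. Suc j \<le> l x) xs)
     = length (filter (\<lambda>x. j \<le> l x) xs)"
  by (induction xs) auto

lemma low_fm_syntax:
  "fv (low_fm Ps ts l k j) \<subseteq> {0, 1} \<union> {j..<j + k}"
  "preds (low_fm Ps ts l k j) \<subseteq> set Ps" "qrank (low_fm Ps ts l k j) = 0"
proof (induction k arbitrary: j)
  case 0
  { case 1 show ?case by (auto simp: foldr_Disj(2) both_fm_syntax)
  next case 2 show ?case by (auto simp: foldr_Disj(3) both_fm_syntax)
  next case 3
    have "qrank (low_fm Ps ts l 0 j) \<le> 0"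
      unfolding low_fm.simps by (rule foldr_Disj(4)) (auto simp: both_fm_syntax)
    then show ?case by simp }
next
  case (Suc k)
  { case 1 show ?case using Suc(1)[of "Suc j"] by (auto simp: foldr_Disj(2) both_fm_syntax)
  next case 2 show ?case using Suc(2)[of "Suc j"] by (auto simp: foldr_Disj(3) both_fm_syntax)
  next case 3
    have "qrank (low_fm Ps ts l (Suc k) j) \<le> 0"
      unfolding low_fm.simps by (rule foldr_Disj(4)) (auto simp: both_fm_syntax Suc(3))
    then show ?case by simp }
qed

lemma up_fm_syntax:
  "fv (up_fm Ps ts l k j) \<subseteq> {0, 1} \<union> {j..<j + k}"
  "preds (up_fm Ps ts l k j) \<subseteq> set Ps" "qrank (up_fm Ps ts l k j) = 0"
proof (induction k arbitrary: j)
  case 0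
  { case 1 show ?case by auto
  next case 2 show ?case by auto
  next case 3 show ?case by auto }
next
  case (Suc k)
  { case 1 show ?case using Suc(1)[of "Suc j"] by (auto simp: foldr_Conj(2) nboth_fm_syntax)
  next case 2 show ?case using Suc(2)[of "Suc j"] by (auto simp: foldr_Conj(3) nboth_fm_syntax)
  next case 3
    have "qrank (foldr Conj (map (nboth_fm Ps) (filter (\<lambda>\<pi>. l \<pi> = j) ts))
            (up_fm Ps ts l k (Suc j))) \<le> 0"
      by (rule foldr_Conj(4)) (auto simp: nboth_fm_syntax Suc(3))
    then show ?case by simp }
qed

text \<open>Each index costs an inequality and a connective (its quantifier is added later), and
  each type costs one copy of \<open>both_fm\<close> with its connective.\<close>

lemma fsize_low_fm:
  assumes "Ps \<noteq> []"
  shows "fsize (low_fm Ps ts l k j)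
    \<le> 2 * k + 1 + 4 * length Ps * length (filter (\<lambda>\<pi>. j \<le> l \<pi>) ts)"
proof (induction k arbitrary: j)
  case 0
  have "fsize (low_fm Ps ts l 0 j) = 4 * length Ps * length (filter (\<lambda>\<pi>. l \<pi> = j) ts) + 1"
    unfolding low_fm.simps fsize.simps
    by (subst foldr_Disj(5)[where c = "4 * length Ps"]) (use both_fm_syntax(4)[OF assms] in auto)
  then show ?case unfolding length_filter_level[of l j ts, symmetric]
    by (simp add: algebra_simps)
next
  case (Suc k)
  have "fsize (low_fm Ps ts l (Suc k) j) = 4 * length Ps * length (filter (\<lambda>\<pi>. l \<pi> = j) ts)
      + (2 + fsize (low_fm Ps ts l k (Suc j)))"
    unfolding low_fm.simps fsize.simps
    by (subst foldr_Disj(5)[where c = "4 * length Ps"]) (use both_fm_syntax(4)[OF assms] in auto)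
  then show ?case
    using Suc[of "Suc j"] unfolding length_filter_level[of l j ts, symmetric]
    by (simp add: algebra_simps)
qed

lemma fsize_up_fm:
  assumes "Ps \<noteq> []"
  shows "fsize (up_fm Ps ts l k j)
    \<le> 2 * k + 1 + 4 * length Ps * length (filter (\<lambda>\<pi>. j \<le> l \<pi>) ts)"
proof (induction k arbitrary: j)
  case 0
  then show ?case by simp
next
  case (Suc k)
  have "fsize (up_fm Ps ts l (Suc k) j) = 4 * length Ps * length (filter (\<lambda>\<pi>. l \<pi> = j) ts)
      + (2 + fsize (up_fm Ps ts l k (Suc j)))"
    unfolding up_fm.simps fsize.simps
    by (subst foldr_Conj(5)[where c = "4 * length Ps"]) (use nboth_fm_syntax(4)[OF assms] in auto)
  then show ?case
    using Suc[of "Suc j"] unfolding length_filter_level[of l j ts, symmetric]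
    by (simp add: algebra_simps)
qed

text \<open>The types tested at position \<open>i\<close> are reached only through the inequalities
  with indices \<open>j, ..., i - 1\<close>. The chain ends in a falsity after the tests at
  \<open>j + k\<close>, so only types with \<open>l \<pi>\<close> from \<open>j\<close> to
  \<open>j + k\<close> can make it true.\<close>

lemma sat_low_fm:
  assumes "set ts \<subseteq> Pow (set Ps)"
  shows "sat n M s (low_fm Ps ts l k j) \<longleftrightarrow>
    (\<exists>\<pi>\<in>set ts. rtype (set Ps) M (s 1) = \<pi> \<and> rtype (set Ps) M (s 0) = \<pi> \<and> j \<le> l \<pi> \<and> l \<pi> \<le> j + k \<and>
       (\<forall>i. j \<le> i \<and> i < l \<pi> \<longrightarrow> s 0 \<noteq> s i))"
proof -
  have both: "sat n M s (both_fm Ps \<pi>) \<longleftrightarrow>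
      rtype (set Ps) M (s 1) = \<pi> \<and> rtype (set Ps) M (s 0) = \<pi>" if "\<pi> \<in> set ts" for \<pi>
    using assms that by (auto simp: both_fm_def sat_type_fm)
  show ?thesis
  proof (induction k arbitrary: j)
    case 0
    show ?case by (auto simp: foldr_Disj(1) both)
  next
    case (Suc k)
    \<comment> \<open>One step of the chain peels off the first index of the range.\<close>
    have split: "(\<forall>i. j \<le> i \<and> i < L \<longrightarrow> s 0 \<noteq> s i) \<longleftrightarrow>
        s 0 \<noteq> s j \<and> (\<forall>i. Suc j \<le> i \<and> i < L \<longrightarrow> s 0 \<noteq> s i)" if "Suc j \<le> L" for L
      using that by (metis Suc_le_eq le_eq_less_or_eq)
    have "sat n M s (low_fm Ps ts l (Suc k) j) \<longleftrightarrow>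
      (\<exists>\<pi>\<in>set ts. l \<pi> = j \<and> rtype (set Ps) M (s 1) = \<pi> \<and> rtype (set Ps) M (s 0) = \<pi>) \<or>
      s 0 \<noteq> s j \<and> sat n M s (low_fm Ps ts l k (Suc j))"
      by (auto simp: foldr_Disj(1) both)
    also have "\<dots> \<longleftrightarrow> (\<exists>\<pi>\<in>set ts. rtype (set Ps) M (s 1) = \<pi> \<and> rtype (set Ps) M (s 0) = \<pi> \<and>
       (l \<pi> = j \<or> Suc j \<le> l \<pi> \<and> l \<pi> \<le> Suc j + k \<and> s 0 \<noteq> s j \<and>
         (\<forall>i. Suc j \<le> i \<and> i < l \<pi> \<longrightarrow> s 0 \<noteq> s i)))"
      unfolding Suc.IH by blast
    also have "\<dots> \<longleftrightarrow> (\<exists>\<pi>\<in>set ts. rtype (set Ps) M (s 1) = \<pi> \<and> rtype (set Ps) M (s 0) = \<pi> \<and>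
       j \<le> l \<pi> \<and> l \<pi> \<le> j + Suc k \<and> (\<forall>i. j \<le> i \<and> i < l \<pi> \<longrightarrow> s 0 \<noteq> s i))"
    proof (intro bex_cong refl conj_cong)
      fix \<pi>
      show "(l \<pi> = j \<or> Suc j \<le> l \<pi> \<and> l \<pi> \<le> Suc j + k \<and> s 0 \<noteq> s j \<and>
               (\<forall>i. Suc j \<le> i \<and> i < l \<pi> \<longrightarrow> s 0 \<noteq> s i)) \<longleftrightarrow>
            (j \<le> l \<pi> \<and> l \<pi> \<le> j + Suc k \<and> (\<forall>i. j \<le> i \<and> i < l \<pi> \<longrightarrow> s 0 \<noteq> s i))"
        using split[of "l \<pi>"] by (cases "Suc j \<le> l \<pi>") auto
    qed
    finally show ?case .
  qed
qed

text \<open>At position \<open>i\<close> the chain succeeds if \<open>y\<close> equals the variable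
  \<open>i\<close>; otherwise it fails if the common type of both points has
  \<open>u \<pi> = i\<close>. It ends in a truth, so types with \<open>u \<pi>\<close> outside the
  range impose nothing.\<close>

lemma sat_up_fm:
  assumes "set ts \<subseteq> Pow (set Ps)"
  shows "sat n M s (up_fm Ps ts u k j) \<longleftrightarrow>
    (\<forall>\<pi>\<in>set ts. rtype (set Ps) M (s 1) = \<pi> \<and> rtype (set Ps) M (s 0) = \<pi> \<and> j \<le> u \<pi> \<and> u \<pi> < j + k \<longrightarrow>
       (\<exists>i. j \<le> i \<and> i \<le> u \<pi> \<and> s 0 = s i))"
proof -
  have nboth: "sat n M s (nboth_fm Ps \<pi>) \<longleftrightarrow>
      \<not> (rtype (set Ps) M (s 1) = \<pi> \<and> rtype (set Ps) M (s 0) = \<pi>)" if "\<pi> \<in> set ts" for \<pi>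
    using assms that by (auto simp: nboth_fm_def sat_ntype_fm)
  show ?thesis
  proof (induction k arbitrary: j)
    case 0
    show ?case by auto
  next
    case (Suc k)
    have split: "(\<exists>i. j \<le> i \<and> i \<le> L \<and> s 0 = s i) \<longleftrightarrow>
        s 0 = s j \<or> (\<exists>i. Suc j \<le> i \<and> i \<le> L \<and> s 0 = s i)" if "j \<le> L" for L
      using that by (metis Suc_le_eq le_eq_less_or_eq)
    have "sat n M s (up_fm Ps ts u (Suc k) j) \<longleftrightarrow> s 0 = s j \<or>
      (\<forall>\<pi>\<in>set ts. rtype (set Ps) M (s 1) = \<pi> \<and> rtype (set Ps) M (s 0) = \<pi> \<longrightarrow> u \<pi> \<noteq> j) \<and>
      sat n M s (up_fm Ps ts u k (Suc j))"
      by (auto simp: foldr_Conj(1) nboth)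
    also have "\<dots> \<longleftrightarrow> (\<forall>\<pi>\<in>set ts. rtype (set Ps) M (s 1) = \<pi> \<and> rtype (set Ps) M (s 0) = \<pi> \<longrightarrow>
       s 0 = s j \<or> u \<pi> \<noteq> j \<and> (Suc j \<le> u \<pi> \<and> u \<pi> < Suc j + k \<longrightarrow>
         (\<exists>i. Suc j \<le> i \<and> i \<le> u \<pi> \<and> s 0 = s i)))"
      unfolding Suc.IH by blast
    also have "\<dots> \<longleftrightarrow> (\<forall>\<pi>\<in>set ts. rtype (set Ps) M (s 1) = \<pi> \<and> rtype (set Ps) M (s 0) = \<pi> \<longrightarrow>
       (j \<le> u \<pi> \<and> u \<pi> < j + Suc k \<longrightarrow> (\<exists>i. j \<le> i \<and> i \<le> u \<pi> \<and> s 0 = s i)))"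
    proof (intro ball_cong refl imp_cong)
      fix \<pi>
      show "(s 0 = s j \<or> u \<pi> \<noteq> j \<and> (Suc j \<le> u \<pi> \<and> u \<pi> < Suc j + k \<longrightarrow>
               (\<exists>i. Suc j \<le> i \<and> i \<le> u \<pi> \<and> s 0 = s i))) \<longleftrightarrow>
            (j \<le> u \<pi> \<and> u \<pi> < j + Suc k \<longrightarrow> (\<exists>i. j \<le> i \<and> i \<le> u \<pi> \<and> s 0 = s i))"
        using split[of "u \<pi>"] by (cases "j \<le> u \<pi>") (auto simp: Suc_le_eq)
    qed
    finally show ?case by blast
  qed
qed

subsection \<open>The sentences bounding the multiplicities of types\<close>

text \<open>The fold ends in a closed tautology of rank 1, which costs two symbols.\<close>

definition emptiness_sentence :: "'p list \<Rightarrow> 'p set list \<Rightarrow> ('p set \<Rightarrow> nat) \<Rightarrow> 'p fm" where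
  "emptiness_sentence Ps ts c =
     foldr Conj
       (map (\<lambda>\<pi>. if c \<pi> = 0 then All 0 (ntype_fm \<pi> 0 Ps) else Ex 0 (type_fm \<pi> 0 Ps)) ts)
       (All 0 (Pos (Eq 0 0)))"

definition low_sentence :: "'p list \<Rightarrow> 'p set list \<Rightarrow> ('p set \<Rightarrow> nat) \<Rightarrow> nat \<Rightarrow> 'p fm" where
  "low_sentence Ps ts l D = foldr All [1..<D] (Ex 0 (low_fm Ps ts l (D - 1) 1))"

definition up_sentence :: "'p list \<Rightarrow> 'p set list \<Rightarrow> ('p set \<Rightarrow> nat) \<Rightarrow> nat \<Rightarrow> 'p fm" where
  "up_sentence Ps ts u U = All 1 (foldr Ex [2..<Suc U] (All 0 (up_fm Ps ts u U 1)))"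

lemma emptiness_sentence_syntax:
  "fv (emptiness_sentence Ps ts c) = {}" "preds (emptiness_sentence Ps ts c) \<subseteq> set Ps"
  "qrank (emptiness_sentence Ps ts c) \<le> 1"
  "Ps \<noteq> [] \<Longrightarrow> fsize (emptiness_sentence Ps ts c) = (2 * length Ps + 1) * length ts + 2"
proof -
  show "fv (emptiness_sentence Ps ts c) = {}" "preds (emptiness_sentence Ps ts c) \<subseteq> set Ps"
    by (auto simp: emptiness_sentence_def foldr_Conj(2,3) type_fm_syntax ntype_fm_syntax)
  show "qrank (emptiness_sentence Ps ts c) \<le> 1"
    unfolding emptiness_sentence_def
    by (rule foldr_Conj(4)) (auto simp: type_fm_syntax ntype_fm_syntax)
  show "fsize (emptiness_sentence Ps ts c) = (2 * length Ps + 1) * length ts + 2" if "Ps \<noteq> []"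
    unfolding emptiness_sentence_def
    by (subst foldr_Conj(5)[where c = "2 * length Ps + 1"])
      (use type_fm_syntax(4)[OF that] ntype_fm_syntax(4)[OF that] in auto)
qed

lemma sat_emptiness_sentence:
  assumes "set ts \<subseteq> Pow (set Ps)"
  shows "sat n M s (emptiness_sentence Ps ts c) \<longleftrightarrow>
    (\<forall>\<pi>\<in>set ts. type_card (set Ps) n M \<pi> = 0 \<longleftrightarrow> c \<pi> = 0)"
proof -
  have "sat n M s (if c \<pi> = 0 then All 0 (ntype_fm \<pi> 0 Ps) else Ex 0 (type_fm \<pi> 0 Ps)) \<longleftrightarrow>
      (type_card (set Ps) n M \<pi> = 0 \<longleftrightarrow> c \<pi> = 0)" if "\<pi> \<in> set ts" for \<pi>
  proof -
    have \<pi>: "\<pi> \<in> Pow (set Ps)" using assms that by blast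
    show ?thesis using type_card_pos_iff[of "set Ps" n M \<pi>]
      by (auto simp: sat_type_fm[OF \<pi>] sat_ntype_fm[OF \<pi>])
  qed
  then show ?thesis
    unfolding emptiness_sentence_def foldr_Conj(1) by (simp del: if_image_distrib)
qed

text \<open>There are \<open>D\<close> quantifiers and a chain with \<open>D - 1\<close>
  inequalities. For \<open>D < 2\<close> the universal block would be empty and the selector,
  variable \<open>1\<close>, would stay free.\<close>

lemma low_sentence_syntax:
  assumes "D \<ge> 2"
  shows "fv (low_sentence Ps ts l D) = {}" "preds (low_sentence Ps ts l D) \<subseteq> set Ps"
    "qrank (low_sentence Ps ts l D) = D"
    "Ps \<noteq> [] \<Longrightarrow> fsize (low_sentence Ps ts l D) \<le> 3 * D + 4 * length Ps * length ts - 1"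
proof -
  show "fv (low_sentence Ps ts l D) = {}" "preds (low_sentence Ps ts l D) \<subseteq> set Ps"
    "qrank (low_sentence Ps ts l D) = D"
    using low_fm_syntax[of Ps ts l "D - 1" 1] assms
    by (auto simp: low_sentence_def foldr_quantifier_syntax)
  assume "Ps \<noteq> []"
  have "4 * length Ps * length (filter (\<lambda>\<pi>. 1 \<le> l \<pi>) ts) \<le> 4 * length Ps * length ts"
    by (intro mult_le_mono2) simp
  moreover have "fsize (low_sentence Ps ts l D) = D + fsize (low_fm Ps ts l (D - 1) 1)"
    using assms by (simp add: low_sentence_def foldr_quantifier_syntax)
  ultimately show "fsize (low_sentence Ps ts l D) \<le> 3 * D + 4 * length Ps * length ts - 1"
    using fsize_low_fm[OF \<open>Ps \<noteq> []\<close>, of ts l "D - 1" 1] assms by linarith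
qed

text \<open>The variables \<open>1, ..., U\<close> and the final \<open>y\<close> make
  \<open>U + 1\<close> quantifiers. This extra rank is why \<open>U\<close> has to stay strictly
  below \<open>d\<close> later.\<close>

lemma up_sentence_syntax:
  assumes "U \<ge> 1"
  shows "fv (up_sentence Ps ts l U) = {}" "preds (up_sentence Ps ts l U) \<subseteq> set Ps"
    "qrank (up_sentence Ps ts l U) = Suc U"
    "Ps \<noteq> [] \<Longrightarrow> fsize (up_sentence Ps ts l U) \<le> 3 * U + 4 * length Ps * length ts + 2"
proof -
  show "fv (up_sentence Ps ts l U) = {}" "preds (up_sentence Ps ts l U) \<subseteq> set Ps"
    "qrank (up_sentence Ps ts l U) = Suc U"
    using up_fm_syntax[of Ps ts l U 1] assms
    by (auto simp: up_sentence_def foldr_quantifier_syntax)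
  assume "Ps \<noteq> []"
  have "4 * length Ps * length (filter (\<lambda>\<pi>. 1 \<le> l \<pi>) ts) \<le> 4 * length Ps * length ts"
    by (intro mult_le_mono2) simp
  moreover have "fsize (up_sentence Ps ts l U) = U + 1 + fsize (up_fm Ps ts l U 1)"
    using assms by (simp add: up_sentence_def foldr_quantifier_syntax) linarith
  ultimately show "fsize (up_sentence Ps ts l U) \<le> 3 * U + 4 * length Ps * length ts + 2"
    using fsize_up_fm[OF \<open>Ps \<noteq> []\<close>, of ts l U 1] by linarith
qed

text \<open>Serves to list all points of a small type by consecutive variables. The list is padded
  with an element of \<open>B\<close>, so that every value is admissible.\<close>

lemma finite_set_indexed:
  assumes "finite A" "card A \<le> k" "A \<subseteq> B" "B \<noteq> {}"
  obtains f :: "nat \<Rightarrow> 'a" where "A \<subseteq> f ` {j..<j + k}" "range f \<subseteq> B"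
proof -
  obtain xs where xs: "set xs = A" "distinct xs" using finite_distinct_list[OF assms(1)] by blast
  then have len: "length xs \<le> k" using assms(2) distinct_card by metis
  obtain b where b: "b \<in> B" using assms(4) by blast
  define f where "f i = (if j \<le> i \<and> i < j + length xs then xs ! (i - j) else b)" for i
  have "a \<in> f ` {j..<j + k}" if a: "a \<in> A" for a
  proof -
    obtain i where i: "i < length xs" "xs ! i = a" using a xs by (metis in_set_conv_nth)
    then have "f (j + i) = a" by (simp add: f_def)
    moreover have "j + i \<in> {j..<j + k}" using i(1) len by simp
    ultimately show ?thesis by blast
  qed
  moreover have "f i \<in> B" for i
  proof (cases "j \<le> i \<and> i < j + length xs")
    case True
    then have "xs ! (i - j) \<in> set xs" by (intro nth_mem) auto
    then show ?thesis using True xs assms(3) by (auto simp: f_def)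
  qed (auto simp: f_def b)
  ultimately show ?thesis using that[of f] by blast
qed

text \<open>The emptiness of each type has to be known separately, as the universally quantified
  variable \<open>1\<close> cannot select an empty type.\<close>

lemma sat_low_sentence:
  assumes ts: "set ts = Pow (set Ps)" and D: "D \<ge> 2"
    and empty: "\<forall>\<pi>\<in>set ts. type_card (set Ps) n M \<pi> = 0 \<longleftrightarrow> l \<pi> = 0"
    and lD: "\<forall>\<pi>\<in>set ts. l \<pi> \<le> D"
  shows "sat n M s (low_sentence Ps ts l D) \<longleftrightarrow>
    (\<forall>\<pi>\<in>set ts. l \<pi> \<le> type_card (set Ps) n M \<pi>)"
proof -
  let ?R = "realizing (set Ps) n M"
  \<comment> \<open>The type selected by variable \<open>1\<close> has a point, hence its level is
    at least 1 and the chain reduces to the one test for this type.\<close>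
  have body: "sat n M s' (Ex 0 (low_fm Ps ts l (D - 1) 1)) \<longleftrightarrow>
      (\<exists>a\<in>?R (rtype (set Ps) M (s' 1)). a \<notin> s' ` {1..<l (rtype (set Ps) M (s' 1))})"
    if "s' 1 \<in> {1..n}" for s'
  proof -
    let ?\<pi> = "rtype (set Ps) M (s' 1)"
    have \<pi>: "?\<pi> \<in> set ts" unfolding ts by (rule rtype_Pow)
    have "type_card (set Ps) n M ?\<pi> > 0" using that by (auto simp: type_card_pos_iff)
    then have l: "1 \<le> l ?\<pi>" "l ?\<pi> \<le> D" using empty lD \<pi> by (auto simp: Suc_le_eq)
    have s1: "(s'(0 := a)) 1 = s' 1" for a by simp
    \<comment> \<open>The indices start at 1, so assigning \<open>y\<close> to variable
      \<open>0\<close> does not change the points that it is compared with.\<close>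
    have im: "(\<forall>i. 1 \<le> i \<and> i < L \<longrightarrow> a \<noteq> (s'(0 := a)) i) \<longleftrightarrow> a \<notin> s' ` {1..<L}" for a L
    proof -
      have "(s'(0 := a)) i = s' i" if "1 \<le> i" for i using that by simp
      then show ?thesis unfolding image_iff Bex_def atLeastLessThan_iff by metis
    qed
    have "sat n M s' (Ex 0 (low_fm Ps ts l (D - 1) 1)) \<longleftrightarrow>
        (\<exists>a\<in>{1..n}. \<exists>\<pi>\<in>set ts. ?\<pi> = \<pi> \<and> rtype (set Ps) M a = \<pi> \<and> 1 \<le> l \<pi> \<and>
           l \<pi> \<le> 1 + (D - 1) \<and> a \<notin> s' ` {1..<l \<pi>})"
      by (simp only: sat.simps sat_low_fm[OF ts[THEN equalityD1]] s1 im fun_upd_same)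
    also have "\<dots> \<longleftrightarrow> (\<exists>a\<in>{1..n}. rtype (set Ps) M a = ?\<pi> \<and> a \<notin> s' ` {1..<l ?\<pi>})"
      using l D \<pi> by (intro bex_cong refl) auto
    also have "\<dots> \<longleftrightarrow> (\<exists>a\<in>?R ?\<pi>. a \<notin> s' ` {1..<l ?\<pi>})"
      unfolding realizing_def by blast
    finally show ?thesis .
  qed
  show ?thesis
  proof
    assume sat: "sat n M s (low_sentence Ps ts l D)"
    show "\<forall>\<pi>\<in>set ts. l \<pi> \<le> type_card (set Ps) n M \<pi>"
    proof (rule ballI, rule ccontr)
      fix \<pi> assume \<pi>: "\<pi> \<in> set ts" and "\<not> l \<pi> \<le> type_card (set Ps) n M \<pi>"
      then have less: "card (?R \<pi>) \<le> l \<pi> - 1" "l \<pi> \<noteq> 0"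
        by (auto simp: type_card_realizing)
      then have "?R \<pi> \<noteq> {}" using empty \<pi> by (auto simp: type_card_realizing)
      \<comment> \<open>With fewer than \<open>l \<pi>\<close> points, the variables
        \<open>1, ..., l \<pi> - 1\<close> can list them all, leaving no \<open>y\<close>. All
        values lie in \<open>\<pi>\<close>, so variable \<open>1\<close> selects this type.\<close>
      from finite_set_indexed[OF finite_realizing less(1) subset_refl this, of 1]
      obtain f where f: "?R \<pi> \<subseteq> f ` {1..<1 + (l \<pi> - 1)}" "range f \<subseteq> ?R \<pi>" by metis
      define s' where "s' x = (if x \<in> set [1..<D] then f x else s x)" for x
      have fin: "f i \<in> {1..n} \<and> rtype (set Ps) M (f i) = \<pi>" for i
        using f(2) by (auto simp: realizing_def)
      have "sat n M s' (Ex 0 (low_fm Ps ts l (D - 1) 1))"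
        using sat fin unfolding low_sentence_def sat_foldr_All
        by (elim allE[of _ s']) (auto simp: s'_def)
      moreover have "s' 1 = f 1" using D by (simp add: s'_def)
      ultimately have "\<exists>a\<in>?R \<pi>. a \<notin> s' ` {1..<l \<pi>}"
        using fin[of 1] body[of s'] by auto
      moreover have "s' ` {1..<l \<pi>} = f ` {1..<l \<pi>}"
        using lD \<pi> by (intro image_cong) (auto simp: s'_def dest!: bspec)
      ultimately show False using f(1) less(2) by auto
    qed
  next
    assume le: "\<forall>\<pi>\<in>set ts. l \<pi> \<le> type_card (set Ps) n M \<pi>"
    show "sat n M s (low_sentence Ps ts l D)"
      unfolding low_sentence_def sat_foldr_All
    proof (intro allI impI)
      fix s' assume "\<forall>x\<in>set [1..<D]. s' x \<in> {1..n}"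
      then have s1: "s' 1 \<in> {1..n}" using D by simp
      let ?\<pi> = "rtype (set Ps) M (s' 1)"
      have \<pi>: "?\<pi> \<in> set ts" unfolding ts by (rule rtype_Pow)
      have "0 < type_card (set Ps) n M ?\<pi>" using s1 by (auto simp: type_card_pos_iff)
      then have "l ?\<pi> \<noteq> 0" using empty \<pi> by auto
      \<comment> \<open>The \<open>l - 1\<close> values excluded cannot exhaust a type with at least
        \<open>l\<close> points.\<close>
      have "card (s' ` {1..<l ?\<pi>}) \<le> l ?\<pi> - 1"
        using card_image_le[of "{1..<l ?\<pi>}" s'] by simp
      then have "card (s' ` {1..<l ?\<pi>}) < card (?R ?\<pi>)"
        using le \<pi> \<open>l ?\<pi> \<noteq> 0\<close> by (fastforce simp: type_card_realizing)
      then have "\<not> ?R ?\<pi> \<subseteq> s' ` {1..<l ?\<pi>}"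
        using card_mono[of "s' ` {1..<l ?\<pi>}" "?R ?\<pi>"] by auto
      then show "sat n M s' (Ex 0 (low_fm Ps ts l (D - 1) 1))"
        unfolding body[of s', OF s1] by blast
    qed
  qed
qed

text \<open>A type has at most \<open>u\<close> points iff, for each of its points taken as variable
  \<open>1\<close>, the variables \<open>2, ..., u\<close> can be chosen to list the remaining ones.
  A selected type is nonempty, so its \<open>u\<close> is at least 1.\<close>

lemma sat_up_sentence:
  assumes ts: "set ts \<subseteq> Pow (set Ps)" and U: "U \<ge> 1"
    and empty: "\<forall>\<pi>\<in>set ts. type_card (set Ps) n M \<pi> = 0 \<longleftrightarrow> u \<pi> = 0"
    and uU: "\<forall>\<pi>\<in>set ts. u \<pi> \<le> U"
  shows "sat n M s (up_sentence Ps ts u U) \<longleftrightarrow>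
    (\<forall>\<pi>\<in>set ts. type_card (set Ps) n M \<pi> \<le> u \<pi>)"
proof -
  let ?R = "realizing (set Ps) n M"
  have body: "sat n M s' (All 0 (up_fm Ps ts u U 1)) \<longleftrightarrow>
      (\<forall>\<pi>\<in>set ts. rtype (set Ps) M (s' 1) = \<pi> \<longrightarrow> ?R \<pi> \<subseteq> s' ` {1..u \<pi>})"
    if "s' 1 \<in> {1..n}" for s'
  proof -
    have u: "u \<pi> \<ge> 1 \<and> u \<pi> < 1 + U" if "\<pi> \<in> set ts" "rtype (set Ps) M (s' 1) = \<pi>" for \<pi>
    proof -
      have "type_card (set Ps) n M \<pi> > 0"
        using that \<open>s' 1 \<in> {1..n}\<close> by (auto simp: type_card_pos_iff)
      then show ?thesis using empty uU that by (auto simp: Suc_le_eq less_Suc_eq_le)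
    qed
    have im: "(\<exists>i\<ge>1. i \<le> L \<and> a = (s'(0 := a)) i) \<longleftrightarrow> a \<in> s' ` {1..L}" for a L
    proof -
      have "(s'(0 := a)) i = s' i" if "1 \<le> i" for i using that by simp
      then show ?thesis unfolding image_iff Bex_def atLeastAtMost_iff by metis
    qed
    have s1: "(s'(0 := a)) 1 = s' 1" for a by simp
    have "sat n M s' (All 0 (up_fm Ps ts u U 1)) \<longleftrightarrow>
        (\<forall>a\<in>{1..n}. \<forall>\<pi>\<in>set ts. rtype (set Ps) M (s' 1) = \<pi> \<and> rtype (set Ps) M a = \<pi> \<and>
           1 \<le> u \<pi> \<and> u \<pi> < 1 + U \<longrightarrow> a \<in> s' ` {1..u \<pi>})"
      by (simp only: sat.simps sat_up_fm[OF ts] s1 im fun_upd_same)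
    also have "\<dots> \<longleftrightarrow> (\<forall>\<pi>\<in>set ts. rtype (set Ps) M (s' 1) = \<pi> \<longrightarrow> ?R \<pi> \<subseteq> s' ` {1..u \<pi>})"
      using u unfolding realizing_def subset_iff by blast
    finally show ?thesis .
  qed
  have expand: "sat n M s (up_sentence Ps ts u U) \<longleftrightarrow>
      (\<forall>a\<in>{1..n}. \<exists>s'. (\<forall>x. x \<notin> set [2..<Suc U] \<longrightarrow> s' x = (s(1 := a)) x) \<and>
        (\<forall>x\<in>set [2..<Suc U]. s' x \<in> {1..n}) \<and> sat n M s' (All 0 (up_fm Ps ts u U 1)))"
    unfolding up_sentence_def sat.simps(6)[where x = 1] sat_foldr_Ex ..
  show ?thesis
  proof
    assume sat: "sat n M s (up_sentence Ps ts u U)"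
    show "\<forall>\<pi>\<in>set ts. type_card (set Ps) n M \<pi> \<le> u \<pi>"
    proof
      fix \<pi> assume \<pi>: "\<pi> \<in> set ts"
      show "type_card (set Ps) n M \<pi> \<le> u \<pi>"
      proof (cases "type_card (set Ps) n M \<pi> = 0")
        case False
        then obtain a where a: "a \<in> {1..n}" "rtype (set Ps) M a = \<pi>"
          using type_card_pos_iff[of "set Ps" n M \<pi>] by auto
        with sat obtain s' where s': "\<forall>x. x \<notin> set [2..<Suc U] \<longrightarrow> s' x = (s(1 := a)) x"
          "sat n M s' (All 0 (up_fm Ps ts u U 1))" unfolding expand by blast
        \<comment> \<open>The existential block starts at 2 and so keeps the selected point.\<close>
        then have "s' 1 = a" by auto
        then have "?R \<pi> \<subseteq> s' ` {1..u \<pi>}" using s'(2) body[of s'] a \<pi> by auto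
        then have "card (?R \<pi>) \<le> card (s' ` {1..u \<pi>})" by (intro card_mono) auto
        also have "\<dots> \<le> u \<pi>" using card_image_le[of "{1..u \<pi>}" s'] by simp
        finally show ?thesis by (simp add: type_card_realizing)
      qed simp
    qed
  next
    assume le: "\<forall>\<pi>\<in>set ts. type_card (set Ps) n M \<pi> \<le> u \<pi>"
    show "sat n M s (up_sentence Ps ts u U)"
      unfolding expand
    proof
      fix a assume a: "a \<in> {1..n}"
      let ?\<pi> = "rtype (set Ps) M a"
      have aR: "a \<in> ?R ?\<pi>" using a by (simp add: realizing_def)
      \<comment> \<open>Variable \<open>1\<close> already lists \<open>a\<close>, so
        \<open>u - 1\<close> variables from \<open>2\<close> on have to cover the rest. For a type
        outside \<open>ts\<close> any points will do.\<close>
      have "\<exists>f. range f \<subseteq> {1..n} \<and> (?\<pi> \<in> set ts \<longrightarrow> ?R ?\<pi> - {a} \<subseteq> f ` {2..<2 + (u ?\<pi> - 1)})"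
      proof (cases "?\<pi> \<in> set ts")
        case True
        have "card (?R ?\<pi> - {a}) \<le> u ?\<pi> - 1"
          using le True aR by (auto simp: type_card_realizing diff_le_mono)
        moreover have "?R ?\<pi> - {a} \<subseteq> {1..n}" by (auto simp: realizing_def)
        moreover have "finite (?R ?\<pi> - {a})" by (simp add: finite_realizing)
        moreover have "{1..n} \<noteq> {}" using a by auto
        ultimately show ?thesis using finite_set_indexed[of "?R ?\<pi> - {a}" "u ?\<pi> - 1" "{1..n}" 2]
          by metis
      qed (use a in \<open>auto intro!: exI[of _ "\<lambda>_. a"]\<close>)
      then obtain f where f: "range f \<subseteq> {1..n}"
        "?\<pi> \<in> set ts \<Longrightarrow> ?R ?\<pi> - {a} \<subseteq> f ` {2..<2 + (u ?\<pi> - 1)}" by blast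
      define s' where "s' x = (if x \<in> set [2..<Suc U] then f x else (s(1 := a)) x)" for x
      have s1: "s' 1 = a" by (simp add: s'_def)
      have "?R ?\<pi> \<subseteq> s' ` {1..u ?\<pi>}" if ts': "?\<pi> \<in> set ts"
      proof
        fix b assume b: "b \<in> ?R ?\<pi>"
        have "type_card (set Ps) n M ?\<pi> > 0" using a by (auto simp: type_card_pos_iff)
        then have u1: "u ?\<pi> \<ge> 1" using empty that by (auto simp: Suc_le_eq)
        show "b \<in> s' ` {1..u ?\<pi>}"
        proof (cases "b = a")
          case True
          then show ?thesis using s1 u1 by (intro image_eqI[of _ _ 1]) auto
        next
          case False
          then obtain i where i: "i \<in> {2..<2 + (u ?\<pi> - 1)}" "b = f i" using f(2)[OF ts'] b by blast
          moreover have "u ?\<pi> \<le> U" using uU that by blast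
          ultimately have "s' i = b" using u1 by (auto simp: s'_def)
          then show ?thesis using i u1 by (intro image_eqI[of _ _ i]) auto
        qed
      qed
      then have "sat n M s' (All 0 (up_fm Ps ts u U 1))"
        using body[of s'] s1 a by auto
      moreover have "\<forall>x\<in>set [2..<Suc U]. s' x \<in> {1..n}" 
        using range_subsetD[OF f(1)] by (simp add: s'_def)
      moreover have "\<forall>x. x \<notin> set [2..<Suc U] \<longrightarrow> s' x = (s(1 := a)) x"
        unfolding s'_def by (intro allI impI) (simp only: if_False)
      ultimately show "\<exists>s'. (\<forall>x. x \<notin> set [2..<Suc U] \<longrightarrow> s' x = (s(1 := a)) x) \<and>
        (\<forall>x\<in>set [2..<Suc U]. s' x \<in> {1..n}) \<and> sat n M s' (All 0 (up_fm Ps ts u U 1))" by blast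
    qed
  qed
qed

section \<open>The combined counting sentence and its size\<close>

text \<open>The parameters serve both bounds: \<open>D\<close> caps the lower bounds,
  \<open>S\<close> is the set of types that also get an upper bound, and \<open>U\<close> bounds
  their prescribed multiplicities. The sentence is the conjunction of the emptiness conditions and
  the two chains.\<close>

lemma counting_sentence_exists:
  assumes "finite \<tau>" "\<tau> \<noteq> {}" "S \<subseteq> Pow \<tau>" "\<forall>\<pi>\<in>S. c \<pi> \<le> U" "D \<le> d" "U < d"
  obtains f :: "'a fm" where "f \<in> FO d \<tau>" "sentence f" "fsize f \<le> 3 * D + 3 * U + c_tau \<tau>"
    "\<And>M. models n M f \<longleftrightarrow> (\<forall>\<pi>\<in>Pow \<tau>. (type_card \<tau> n M \<pi> = 0 \<longleftrightarrow> c \<pi> = 0) \<and>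
       min (c \<pi>) D \<le> type_card \<tau> n M \<pi> \<and> (\<pi> \<in> S \<longrightarrow> type_card \<tau> n M \<pi> \<le> c \<pi>))"
proof -
  obtain Ps where Ps: "set Ps = \<tau>" "distinct Ps" using finite_distinct_list assms(1) by blast
  obtain ts where ts: "set ts = Pow (set Ps)" "distinct ts"
    using finite_distinct_list[of "Pow (set Ps)"] by auto
  have ne: "Ps \<noteq> []" using Ps assms(2) by auto
  define us where "us = filter (\<lambda>\<pi>. \<pi> \<in> S) ts"
  have us: "set us = S" using assms(3) ts Ps by (auto simp: us_def)
  define l where "l \<pi> = min (c \<pi>) D" for \<pi>
  define T :: "'a fm" where "T = All 0 (Pos (Eq 0 0))"
  define F where "F = emptiness_sentence Ps ts c"
  \<comment> \<open>For \<open>D < 2\<close> the lower bounds follow from the emptiness conditions,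
    and for \<open>U = 0\<close> so do the upper bounds. In these cases a tautology replaces the
    chain.\<close>
  define A where "A = (if D \<ge> 2 then low_sentence Ps ts l D else T)"
  define B where "B = (if U \<ge> 1 then up_sentence Ps us c U else T)"
  have lenp: "length Ps = card \<tau>" using Ps distinct_card by metis
  have lent: "length ts = 2 ^ card \<tau>"
    using distinct_card[OF ts(2)] card_Pow[OF assms(1)] unfolding ts(1) Ps(1) by simp
  have p: "1 \<le> length Ps" using ne by (simp add: Suc_le_eq)
  have t: "2 \<le> length ts"
    using p unfolding lent lenp by (metis power_increasing power_one_right one_le_numeral)
  define q where "q = length Ps * length ts"
  have q: "length ts \<le> q" using p by (simp add: q_def)
  have "length us \<le> length ts" by (simp add: us_def)
  then have us_len: "4 * length Ps * length us \<le> 4 * q"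
    unfolding q_def by simp
  have T: "fv T = {}" "preds T = {}" "qrank T = 1" "fsize T = 2" "sat n M s T" for M s
    by (auto simp: T_def)
  have sF: "fsize F = 2 * q + length ts + 2"
    using emptiness_sentence_syntax(4)[OF ne, of ts c] by (simp add: F_def q_def algebra_simps)
  have sA: "fsize A + 1 \<le> 3 * D + 4 * q"
  proof (cases "D \<ge> 2")
    case True
    from low_sentence_syntax(4)[OF this ne, of ts l] have "fsize A \<le> 3 * D + 4 * q - 1"
      using True by (simp add: A_def q_def mult.assoc)
    then show ?thesis using True by linarith
  next
    case False
    then show ?thesis using t q by (simp add: A_def T)
  qed
  have sB: "fsize B \<le> 3 * U + 4 * q + 2"
  proof (cases "U \<ge> 1")
    case True
    from up_sentence_syntax(4)[OF this ne, of us c] us_len show ?thesis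
      using True by (simp add: B_def)
  next
    case False
    then show ?thesis by (simp add: B_def T)
  qed
  have "c_tau \<tau> = 15 * q" by (simp add: c_tau_def lenp lent q_def)
  \<comment> \<open>The part besides \<open>3 * D + 3 * U\<close> is at most
    \<open>10 * q + length ts + 5\<close>, and \<open>2 \<le> length ts \<le> q\<close> brings this
    below \<open>15 * q\<close>.\<close>
  then have size: "fsize (Conj F (Conj A B)) \<le> 3 * D + 3 * U + c_tau \<tau>"
    using sF sA sB t q by simp
  have fvs: "fv F = {}" "fv A = {}" "fv B = {}"
    by (simp_all add: F_def A_def B_def T emptiness_sentence_syntax(1) low_sentence_syntax(1)
        up_sentence_syntax(1))
  have preds: "preds F \<subseteq> \<tau>" "preds A \<subseteq> \<tau>" "preds B \<subseteq> \<tau>"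
    unfolding Ps(1)[symmetric]
    by (simp_all add: F_def A_def B_def T emptiness_sentence_syntax(2) low_sentence_syntax(2)
        up_sentence_syntax(2))
  have "qrank F \<le> d"
    using emptiness_sentence_syntax(3)[of Ps ts c] assms(6) unfolding F_def by linarith
  moreover have "qrank A \<le> d" "qrank B \<le> d"
    using assms(5,6) by (simp_all add: A_def B_def T low_sentence_syntax(3) up_sentence_syntax(3))
  ultimately have qr: "qrank F \<le> d" "qrank A \<le> d" "qrank B \<le> d" .
  have sat: "sat n M s (Conj F (Conj A B)) \<longleftrightarrow>
      (\<forall>\<pi>\<in>Pow \<tau>. (type_card \<tau> n M \<pi> = 0 \<longleftrightarrow> c \<pi> = 0) \<and> l \<pi> \<le> type_card \<tau> n M \<pi> \<and>
        (\<pi> \<in> S \<longrightarrow> type_card \<tau> n M \<pi> \<le> c \<pi>))" for M s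
  proof (cases "\<forall>\<pi>\<in>Pow \<tau>. type_card \<tau> n M \<pi> = 0 \<longleftrightarrow> c \<pi> = 0")
    \<comment> \<open>If the emptiness conditions fail, both sides are false; otherwise they supply
      the hypothesis that the lemmas on the two chains require.\<close>
    case False
    then have "\<not> sat n M s F"
      using sat_emptiness_sentence[of ts Ps n M s c] by (simp add: F_def ts Ps(1))
    then show ?thesis using False by (simp only: sat.simps) blast
  next
    case True
    then have "sat n M s F"
      using sat_emptiness_sentence[of ts Ps n M s c] by (simp add: F_def ts Ps(1))
    moreover have "sat n M s A \<longleftrightarrow> (\<forall>\<pi>\<in>Pow \<tau>. l \<pi> \<le> type_card \<tau> n M \<pi>)"
    proof (cases "D \<ge> 2")
      case D: True
      have "\<forall>\<pi>\<in>set ts. type_card (set Ps) n M \<pi> = 0 \<longleftrightarrow> l \<pi> = 0" "\<forall>\<pi>\<in>set ts. l \<pi> \<le> D"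
        using True D unfolding ts(1) Ps(1) l_def by (auto simp: min_def)
      from sat_low_sentence[OF ts(1) D this] show ?thesis
        using D unfolding A_def ts(1) Ps(1) by simp
    next
      case False
      have "l \<pi> \<le> type_card \<tau> n M \<pi>" if "\<pi> \<in> Pow \<tau>" for \<pi>
        using True[rule_format, OF that] False by (auto simp: l_def min_def)
      then show ?thesis using False by (simp add: A_def T)
    qed
    moreover have "sat n M s B \<longleftrightarrow> (\<forall>\<pi>\<in>S. type_card \<tau> n M \<pi> \<le> c \<pi>)"
    proof (cases "U \<ge> 1")
      case U: True
      have "set us \<subseteq> Pow (set Ps)" "\<forall>\<pi>\<in>set us. type_card (set Ps) n M \<pi> = 0 \<longleftrightarrow> c \<pi> = 0"
        "\<forall>\<pi>\<in>set us. c \<pi> \<le> U"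
        using True assms(3,4) unfolding us Ps(1) by blast+
      from sat_up_sentence[OF this(1) U this(2,3)] show ?thesis
        using U unfolding B_def us Ps(1) by simp
    next
      case False
      have "type_card \<tau> n M \<pi> \<le> c \<pi>" if "\<pi> \<in> S" for \<pi>
      proof -
        have "c \<pi> = 0" using assms(4) that False by auto
        moreover have "\<pi> \<in> Pow \<tau>" using assms(3) that by blast
        ultimately show ?thesis using True by simp
      qed
      then show ?thesis using False by (simp add: B_def T)
    qed
    ultimately show ?thesis using True assms(3) by auto
  qed
  have sen: "sentence (Conj F (Conj A B))" using fvs by (simp add: sentence_def)
  show ?thesis
  proof (rule that)
    show "Conj F (Conj A B) \<in> FO d \<tau>" using preds qr by (simp add: FO_def)
    show "models n M (Conj F (Conj A B)) \<longleftrightarrow> (\<forall>\<pi>\<in>Pow \<tau>. (type_card \<tau> n M \<pi> = 0 \<longleftrightarrow> c \<pi> = 0) \<and>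
       min (c \<pi>) D \<le> type_card \<tau> n M \<pi> \<and> (\<pi> \<in> S \<longrightarrow> type_card \<tau> n M \<pi> \<le> c \<pi>))" for M
      unfolding models_iff_sat[OF sen, of n M undefined] sat l_def ..
  qed (fact sen size)+
qed

subsection \<open>Bounds on the description complexity\<close>

lemma description_complexity_le:
  assumes "f \<in> FO d \<tau>" "sentence f"
    and "\<And>M'. is_model \<tau> n M' \<Longrightarrow> models n M' f \<longleftrightarrow> equiv_d \<tau> n d M' M"
  shows "description_complexity \<tau> n d M \<le> enat (fsize f)"
  unfolding description_complexity_def using assms by (intro INF_lower) auto

text \<open>Lower bounds capped at \<open>d\<close> are imposed on all types, upper bounds only on
  those with fewer than \<open>d\<close> points: this fixes each multiplicity below \<open>d\<close>
  and forces at least \<open>d\<close> points elsewhere.\<close>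

lemma description_complexity_below:
  assumes "finite \<tau>" "\<tau> \<noteq> {}" "U < d"
    and U: "\<And>\<pi>. \<pi> \<in> Pow \<tau> \<Longrightarrow> type_card \<tau> n M \<pi> < d \<Longrightarrow> type_card \<tau> n M \<pi> \<le> U"
  shows "description_complexity \<tau> n d M \<le> enat (3 * d + 3 * U + c_tau \<tau>)"
proof -
  let ?c = "type_card \<tau> n M"
  let ?S = "{\<pi> \<in> Pow \<tau>. ?c \<pi> < d}"
  have S: "?S \<subseteq> Pow \<tau>" "\<forall>\<pi>\<in>?S. ?c \<pi> \<le> U" using U by auto
  obtain f where f: "f \<in> FO d \<tau>" "sentence f" "fsize f \<le> 3 * d + 3 * U + c_tau \<tau>"
    "\<And>M'. models n M' f \<longleftrightarrow> (\<forall>\<pi>\<in>Pow \<tau>. (type_card \<tau> n M' \<pi> = 0 \<longleftrightarrow> ?c \<pi> = 0) \<and>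
       min (?c \<pi>) d \<le> type_card \<tau> n M' \<pi> \<and> (\<pi> \<in> ?S \<longrightarrow> type_card \<tau> n M' \<pi> \<le> ?c \<pi>))"
    by (rule counting_sentence_exists[OF assms(1,2) S order_refl \<open>U < d\<close>, of n]) (rule that)
  have "models n M' f \<longleftrightarrow> equiv_d \<tau> n d M' M" for M'
    unfolding f(4) equiv_d_def using \<open>U < d\<close> by (intro ball_cong refl) auto
  then have "description_complexity \<tau> n d M \<le> enat (fsize f)"
    by (rule description_complexity_le[OF f(1,2)])
  also have "\<dots> \<le> enat (3 * d + 3 * U + c_tau \<tau>)" using f(3) by simp
  finally show ?thesis .
qed

text \<open>Both chains stop at \<open>e\<close>, which suffices to count every type other than
  \<open>\<pi>\<^sub>0\<close> exactly; the multiplicity of \<open>\<pi>\<^sub>0\<close> is then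
  what remains of \<open>n\<close>.\<close>

lemma description_complexity_all_but_one:
  assumes "finite \<tau>" "\<tau> \<noteq> {}" "e < d" "\<pi>\<^sub>0 \<in> Pow \<tau>"
    and e: "\<And>\<pi>. \<pi> \<in> Pow \<tau> - {\<pi>\<^sub>0} \<Longrightarrow> type_card \<tau> n M \<pi> \<le> e"
  shows "description_complexity \<tau> n d M \<le> enat (6 * e + c_tau \<tau>)"
proof -
  let ?c = "type_card \<tau> n M"
  let ?S = "Pow \<tau> - {\<pi>\<^sub>0}"
  have S: "?S \<subseteq> Pow \<tau>" "\<forall>\<pi>\<in>?S. ?c \<pi> \<le> e" "e \<le> d" using e \<open>e < d\<close> by auto
  obtain f where f: "f \<in> FO d \<tau>" "sentence f" "fsize f \<le> 3 * e + 3 * e + c_tau \<tau>"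
    "\<And>M'. models n M' f \<longleftrightarrow> (\<forall>\<pi>\<in>Pow \<tau>. (type_card \<tau> n M' \<pi> = 0 \<longleftrightarrow> ?c \<pi> = 0) \<and>
       min (?c \<pi>) e \<le> type_card \<tau> n M' \<pi> \<and> (\<pi> \<in> ?S \<longrightarrow> type_card \<tau> n M' \<pi> \<le> ?c \<pi>))"
    by (rule counting_sentence_exists[OF assms(1,2) S \<open>e < d\<close>, of n]) (rule that)
  have "models n M' f \<longleftrightarrow> equiv_d \<tau> n d M' M" for M'
  proof -
    let ?c' = "type_card \<tau> n M'"
    have all: "\<forall>\<pi>\<in>Pow \<tau>. ?c' \<pi> = ?c \<pi>" if "\<forall>\<pi>\<in>?S. ?c' \<pi> = ?c \<pi>"
    proof -
      have fin: "finite (Pow \<tau>)" using assms(1) by simp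
      have "?c' \<pi>\<^sub>0 + sum ?c' ?S = ?c \<pi>\<^sub>0 + sum ?c ?S"
        unfolding sum.remove[OF fin assms(4), symmetric] sum_type_card[OF assms(1)] ..
      moreover have "sum ?c' ?S = sum ?c ?S" using that by (intro sum.cong) auto
      ultimately show ?thesis using that by auto
    qed
    show ?thesis
    proof
      assume m: "models n M' f"
      have "?c' \<pi> = ?c \<pi>" if "\<pi> \<in> ?S" for \<pi>
      proof -
        have "min (?c \<pi>) e \<le> ?c' \<pi>" "?c' \<pi> \<le> ?c \<pi>" using m that unfolding f(4) by auto
        \<comment> \<open>The multiplicity is at most \<open>e\<close>, so capping the lower bound
          at \<open>e\<close> loses nothing.\<close>
        then show ?thesis using e[OF that] by simp
      qed
      then have "\<forall>\<pi>\<in>Pow \<tau>. ?c' \<pi> = ?c \<pi>" by (intro all) blast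
      then show "equiv_d \<tau> n d M' M" unfolding equiv_d_def by blast
    next
      assume equiv: "equiv_d \<tau> n d M' M"
      have "?c' \<pi> = ?c \<pi>" if "\<pi> \<in> ?S" for \<pi>
      proof -
        have "?c \<pi> < d" using e[OF that] \<open>e < d\<close> by simp
        then show ?thesis using equiv that unfolding equiv_d_def by blast
      qed
      \<comment> \<open>Equality at \<open>\<pi>\<^sub>0\<close> has to be recovered too, because
        the sentence also has an emptiness condition and a lower bound for it.\<close>
      then have eq: "\<forall>\<pi>\<in>Pow \<tau>. ?c' \<pi> = ?c \<pi>" by (intro all) blast
      show "models n M' f" unfolding f(4) using eq by auto
    qed
  qed
  then have "description_complexity \<tau> n d M \<le> enat (fsize f)"
    by (rule description_complexity_le[OF f(1,2)])
  also have "\<dots> \<le> enat (6 * e + c_tau \<tau>)" using f(3) by simp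
  finally show ?thesis .
qed

text \<open>The only type is realized by all \<open>n\<close> points, so there is a single class and
  a tautology describes it. Here \<open>c_tau\<close> is 0, which leaves no room for the general
  sentence.\<close>

lemma description_complexity_empty_vocabulary:
  assumes "d \<ge> 1"
  shows "description_complexity {} n d M \<le> 2"
proof -
  let ?f = "All 0 (Pos (Eq 0 0)) :: 'a fm"
  have "equiv_d {} n d M' M" for M'
    using sum_type_card[of "{}" n M'] sum_type_card[of "{}" n M] by (simp add: equiv_d_def)
  moreover have "?f \<in> FO d {}" "sentence ?f" "models n M' ?f" for M'
    using assms by (simp_all add: FO_def sentence_def models_def)
  ultimately have "description_complexity {} n d M \<le> enat (fsize ?f)"
    by (intro description_complexity_le) simp_all
  then show ?thesis by (simp add: numeral_eq_enat eval_nat_numeral)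
qed

section \<open>From entries of the sorted tuple back to multiplicities of types\<close>

lemma set_class_tuple:
  assumes "finite \<tau>"
  shows "set (class_tuple \<tau> n d M) = (\<lambda>\<pi>. min (type_card \<tau> n M \<pi>) d) ` Pow \<tau>"
  using assms by (simp add: class_tuple_def)

text \<open>In ascending order only the last entry can exceed the one before it. The tuple forgets
  which type an entry comes from, so entries above the threshold are counted as a multiset, which
  shows that at most one type exceeds it.\<close>

lemma all_but_one_le_entry:
  assumes "finite \<tau>" "t = 2 ^ card \<tau>" "t \<ge> 2" "m = class_tuple \<tau> n d M"
  obtains \<pi>\<^sub>0 where "\<pi>\<^sub>0 \<in> Pow \<tau>"
    "\<And>\<pi>. \<pi> \<in> Pow \<tau> - {\<pi>\<^sub>0} \<Longrightarrow> min (type_card \<tau> n M \<pi>) d \<le> entry m (t - 1)"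
proof -
  let ?v = "\<lambda>\<pi>. min (type_card \<tau> n M \<pi>) d"
  let ?e = "entry m (t - 1)"
  let ?X = "{\<pi> \<in> Pow \<tau>. ?e < ?v \<pi>}"
  have len: "length m = t" using assms length_class_tuple by metis
  \<comment> \<open>Entries are numbered from 1, so \<open>entry m (t - 1)\<close> is
    \<open>m ! (t - 2)\<close>.\<close>
  have le: "m ! i \<le> ?e" if "i < t - 1" for i
    using that len assms(3) sorted_nth_mono[OF sorted_class_tuple, of i "t - 2" \<tau> n d M]
    by (simp add: entry_def assms(4) numeral_2_eq_2)
  have "\<forall>x\<in>set (take (t - 1) m). x \<le> ?e"
    using le len by (auto simp: in_set_conv_nth)
  then have "filter (\<lambda>x. ?e < x) (take (t - 1) m) = []"
    by (auto simp: filter_empty_conv not_less)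
  then have "filter (\<lambda>x. ?e < x) m = filter (\<lambda>x. ?e < x) (drop (t - 1) m)"
    by (metis append_take_drop_id filter_append self_append_conv2)
  then have "length (filter (\<lambda>x. ?e < x) m) \<le> 1"
    using length_filter_le[of "\<lambda>x. ?e < x" "drop (t - 1) m"] len assms(3) by simp
  moreover have "card ?X = size (filter_mset (\<lambda>x. ?e < x) (mset m))"
  proof -
    have "mset m = image_mset ?v (mset_set (Pow \<tau>))"
      by (simp add: assms(4) class_tuple_def)
    then have "filter_mset (\<lambda>x. ?e < x) (mset m) = image_mset ?v (mset_set ?X)"
      using assms(1) by (simp add: filter_mset_image_mset)
    then show ?thesis by simp
  qed
  ultimately have "card ?X \<le> 1" by (metis mset_filter size_mset)
  moreover have "finite ?X" using assms(1) by simp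
  ultimately have one: "\<pi> = \<pi>'" if "\<pi> \<in> ?X" "\<pi>' \<in> ?X" for \<pi> \<pi>'
    using that card_le_Suc0_iff_eq[of ?X] by auto
  show ?thesis
  proof (cases "?X = {}")
    case True
    then have "?v \<pi> \<le> ?e" if "\<pi> \<in> Pow \<tau>" for \<pi>
      using that unfolding not_less[symmetric] by blast
    then show ?thesis by (intro that[of "{}"]) simp_all
  next
    case False
    then obtain \<pi>\<^sub>0 where "\<pi>\<^sub>0 \<in> ?X" by blast
    then have "?v \<pi> \<le> ?e" if "\<pi> \<in> Pow \<tau> - {\<pi>\<^sub>0}" for \<pi>
      using that one[of \<pi> \<pi>\<^sub>0] unfolding not_less[symmetric] by blast
    then show ?thesis using \<open>\<pi>\<^sub>0 \<in> ?X\<close> by (intro that[of \<pi>\<^sub>0]) simp_all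
  qed
qed

theorem theorem2:
  fixes \<tau> :: "'p set" and n d t m_r :: nat and M :: "'p \<Rightarrow> nat set" and m :: "nat list"
  assumes "finite \<tau>"
    and "t = 2 ^ card \<tau>"
    and "d \<ge> 1"
    and "is_model \<tau> n M"
    and "m = class_tuple \<tau> n d M"
    and "m_r = largest_below d m"
  shows "description_complexity \<tau> n d M \<le> enat (3 * d + 3 * m_r + c_tau \<tau>)
    \<and> (t \<ge> 2 \<and> entry m (t - 1) < d \<longrightarrow>
         description_complexity \<tau> n d M \<le> enat (6 * entry m (t - 1) + c_tau \<tau>))"
proof (cases "\<tau> = {}")
  case True
  have "enat 2 \<le> enat (3 * d + 3 * m_r + c_tau \<tau>)" using assms(3) by simp
  with description_complexity_empty_vocabulary[OF assms(3), of n M] show ?thesis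
    \<comment> \<open>Here \<open>t = 1\<close>, so the second claim is vacuous.\<close>
    using assms(2) True by (auto simp: numeral_eq_enat intro: order_trans)
next
  case False
  let ?K = "insert 0 {k \<in> set m. k < d}"
  have "m_r \<in> ?K" unfolding assms(6) largest_below_def by (rule Max_in) auto
  \<comment> \<open>The default value 0 is below \<open>d\<close> as well, because \<open>d\<close>
    is positive.\<close>
  then have "m_r < d" using assms(3) by auto
  moreover have "type_card \<tau> n M \<pi> \<le> m_r" if "\<pi> \<in> Pow \<tau>" "type_card \<tau> n M \<pi> < d" for \<pi>
  proof -
    have "type_card \<tau> n M \<pi> = min (type_card \<tau> n M \<pi>) d" using that(2) by simp
    then have "type_card \<tau> n M \<pi> \<in> ?K"
      using that unfolding assms(5) set_class_tuple[OF assms(1)] by blast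
    then show ?thesis unfolding assms(6) largest_below_def by (intro Max_ge) auto
  qed
  ultimately have 1: "description_complexity \<tau> n d M \<le> enat (3 * d + 3 * m_r + c_tau \<tau>)"
    by (rule description_complexity_below[OF assms(1) False])
  have 2: "description_complexity \<tau> n d M \<le> enat (6 * entry m (t - 1) + c_tau \<tau>)"
    if t: "t \<ge> 2" and less: "entry m (t - 1) < d"
  proof -
    obtain \<pi>\<^sub>0 where \<pi>\<^sub>0: "\<pi>\<^sub>0 \<in> Pow \<tau>"
      "\<And>\<pi>. \<pi> \<in> Pow \<tau> - {\<pi>\<^sub>0} \<Longrightarrow> min (type_card \<tau> n M \<pi>) d \<le> entry m (t - 1)"
      by (rule all_but_one_le_entry[OF assms(1,2) t assms(5)]) (rule that)
    \<comment> \<open>As the entry is below \<open>d\<close>, the minimum with \<open>d\<close> is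
      the multiplicity itself.\<close>
    have "type_card \<tau> n M \<pi> \<le> entry m (t - 1)" if "\<pi> \<in> Pow \<tau> - {\<pi>\<^sub>0}" for \<pi>
      using \<pi>\<^sub>0(2)[OF that] less by simp
    with less \<pi>\<^sub>0(1) show ?thesis by (rule description_complexity_all_but_one[OF assms(1) False])
  qed
  from 1 2 show ?thesis by blast
qed

end
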